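(* Let $\mathbb{K}=\mathbb{R}$ or $\mathbb{C}$ and let $(K_n)_{n=1}^\infty$ be the sequence of the optimal constants satisfying the multilinear Bohnenblust--Hille inequality over $\mathbb{K}$. If there is $M\in[-\infty,\infty]$ such that $$\lim_{n\to\infty}(K_{n+1}-K_n)=M,$$ then $M=0$.
   Context: For $\mathbb{K}=\mathbb{R}$ or $\mathbb{C}$ and a positive integer $n$, $K_n$ denotes the optimal constant in the $n$-linear Bohnenblust--Hille inequality over $\mathbb{K}$, i.e. the smallest $C\in[1,\infty)$ such that $$\left(\sum_{i_1,\ldots,i_n=1}^N |U(e_{i_1},\ldots,e_{i_n})|^{\frac{2n}{n+1}}\right)^{\frac{n+1}{2n}}\le C\,\sup|U(z_1,\ldots,z_n)|$$ for all positive integers $N$ and all $n$-linear forms $U:\mathbb{K}^N\times\cdots\times\mathbb{K}^N\to\mathbb{K}$, where $(e_i)_{i=1}^N$ is the canonical basis of $\mathbb{K}^N$ and the supremum is over all $z_1,\ldots,z_n$ in the open unit ball of $\mathbb{K}^N$ with the sup norm (the open unit polydisc if $\mathbb{K}=\mathbb{C}$). Such finite constants exist (Bohnenblust--Hille theorem). *)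

theory Defs
  imports Complex_Main "HOL-Library.Extended_Real" "HOL-Library.FuncSet"
    "Jordan_Normal_Form.Matrix"
begin

text \<open>
  The space \<open>K\<^sup>N\<close> is \<^term>\<open>carrier_vec N\<close>. An \<open>n\<close>-tuple of vectors is an extensional
  function on \<^term>\<open>{..<n}\<close>, so components and coordinates are numbered from 0.
\<close>

definition multilinear_form ::
  "nat \<Rightarrow> nat \<Rightarrow> ((nat \<Rightarrow> 'a::field vec) \<Rightarrow> 'a) \<Rightarrow> bool" where
  "multilinear_form n N U \<longleftrightarrow>
     (\<forall>z \<in> {..<n} \<rightarrow>\<^sub>E carrier_vec N. \<forall>k<n.
        (\<forall>v \<in> carrier_vec N. \<forall>w \<in> carrier_vec N.
            U (z(k := v + w)) = U (z(k := v)) + U (z(k := w))) \<and>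
        (\<forall>a. \<forall>v \<in> carrier_vec N. U (z(k := a \<cdot>\<^sub>v v)) = a * U (z(k := v))))"

definition polydisc :: "nat \<Rightarrow> 'a::real_normed_field vec set" where
  "polydisc N = {v \<in> carrier_vec N. \<forall>i<N. norm (v $ i) < 1}"

text \<open>
  The real supremum below is the actual one whenever \<open>U\<close> is multilinear, since \<open>U\<close> is then
  bounded on the polydisc.
\<close>

definition BH_inequality ::
  "nat \<Rightarrow> nat \<Rightarrow> ((nat \<Rightarrow> 'a::real_normed_field vec) \<Rightarrow> 'a) \<Rightarrow> real \<Rightarrow> bool" where
  "BH_inequality n N U C \<longleftrightarrow>
     (\<Sum>i \<in> {..<n} \<rightarrow>\<^sub>E {..<N}.
         norm (U (\<lambda>k\<in>{..<n}. unit_vec N (i k))) powr (2 * real n / (real n + 1)))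
       powr ((real n + 1) / (2 * real n))
     \<le> C * (SUP z \<in> {..<n} \<rightarrow>\<^sub>E polydisc N. norm (U z))"

text \<open>
  The scalar field is passed as a type argument. Only \<open>n \<ge> 1\<close> is meaningful. The least
  element exists by the Bohnenblust--Hille theorem.
\<close>

definition BH_const :: "'a::real_normed_field itself \<Rightarrow> nat \<Rightarrow> real" where
  "BH_const (_ :: 'a itself) n =
     (LEAST C. 1 \<le> C \<and>
        (\<forall>N\<ge>1. \<forall>U :: (nat \<Rightarrow> 'a vec) \<Rightarrow> 'a.
            multilinear_form n N U \<longrightarrow> BH_inequality n N U C))"

end

theory Submission
  imports Defs "HOL-Analysis.Inner_Product" "HOL-Analysis.Convex"
    "HOL-Analysis.Elementary_Metric_Spaces"
begin

text \<open>
  Write \<open>K\<^sub>n\<close> for the optimal constant. Along the powers of two it grows more slowly than linearly,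
  because \<open>K\<^sub>2\<^sub>n \<le> \<surd>3 K\<^sub>n\<close> and \<open>\<surd>3 < 2\<close>: starting from \<open>K\<^sub>1 \<le> 1\<close>, the constant at \<open>n = 2\<^sup>k\<close> lies
  between \<open>1\<close> and \<open>\<surd>3\<^sup>k\<close>. If the increments had a limit \<open>M > 0\<close> (possibly infinite), telescoping
  would make \<open>K\<^sub>n\<close> grow at least linearly, which the upper bound forbids at large powers of two. If
  \<open>M < 0\<close>, telescoping would drive \<open>K\<^sub>n\<close> to \<open>-\<infinity>\<close>, which the lower bound forbids
  (\<open>increment_limit_zero\<close>). Only the values at powers of two need to be estimated.

  The doubling step (\<open>array_BH_double\<close>) splits the \<open>2n\<close> slots of a form into two blocks \<open>A\<close> and \<open>B\<close> of
  size \<open>n\<close>. Inserting random sign vectors in the slots of \<open>B\<close> leaves an \<open>n\<close>-linear form in the slots of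
  \<open>A\<close>, with the same bound, to which the inequality with constant \<open>K\<^sub>n\<close> and exponent
  \<open>p = 2n/(n+1)\<close> applies. Averaging over the signs and using a Khinchine inequality, one gets a
  mixed-norm estimate: \<open>\<ell>\<^sub>2\<close> in the indices of \<open>B\<close>, then \<open>\<ell>\<^sub>p\<close> in those of \<open>A\<close>
  (\<open>array_BH_mixed\<close>). The roles of \<open>A\<close> and \<open>B\<close> can be exchanged, and Blei's interpolation
  (\<open>Blei_two_block\<close>) turns the two estimates into one in \<open>\<ell>\<^sub>q\<close> with \<open>2/q = 1/2 + 1/p\<close>. This gives
  \<open>q = 4n/(2n+1)\<close>, the exponent belonging to \<open>2n\<close>.

  The size of the Khinchine constant decides everything. The fourth moment of an \<open>n\<close>-fold
  decoupled sign sum is at most \<open>3\<^sup>n\<close> times the square of its second moment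
  (\<open>chaos_moments\<close>). This is exponential in \<open>n\<close>, but \<open>p\<close> is so close to \<open>2\<close> that interpolating
  \<open>L\<^sub>2\<close> between \<open>L\<^sub>p\<close> and \<open>L\<^sub>4\<close> raises the factor \<open>3\<^sup>n\<close> only to the power \<open>1/(2n)\<close>: the constant is
  \<open>\<surd>3\<close> for every \<open>n\<close> (\<open>chaos_Khinchine\<close>).

  The real and the complex case are the same: scalars enter only through their norm, which comes
  from a real inner product and is multiplicative.
\<close>

section \<open>Inequalities of Hoelder, Minkowski and Blei\<close>

text \<open>
  The convention \<open>0 powr 0 = 0\<close> would break this at \<open>x = 0\<close> if \<open>k\<close> were \<open>0\<close>.
\<close>

lemma power_powr:
  fixes x :: real
  assumes "0 \<le> x" "0 < k"
  shows "(x ^ k) powr a = x powr (real k * a)"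
proof (cases "x = 0")
  case False
  with assms have "x ^ k = x powr real k" by (simp add: powr_realpow)
  then show ?thesis by (simp add: powr_powr)
qed (use assms in simp)

text \<open>
  Homogeneous form of Hoelder's inequality, with exponents \<open>1/\<alpha>\<close> and \<open>1/\<beta>\<close>: normalise both sums to
  \<open>1\<close> and sum Young's inequality over the index set.
\<close>

lemma Holder_sum_powr:
  fixes f g :: "'i \<Rightarrow> real"
  assumes "finite I" and f: "\<And>i. i \<in> I \<Longrightarrow> 0 \<le> f i" and g: "\<And>i. i \<in> I \<Longrightarrow> 0 \<le> g i"
    and "0 < \<alpha>" "0 < \<beta>" "\<alpha> + \<beta> = 1"
  shows "(\<Sum>i\<in>I. f i powr \<alpha> * g i powr \<beta>) \<le> sum f I powr \<alpha> * sum g I powr \<beta>"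
proof (cases "sum f I = 0 \<or> sum g I = 0")
  case True
  then have "(\<forall>i\<in>I. f i = 0) \<or> (\<forall>i\<in>I. g i = 0)"
    using assms by (simp add: sum_nonneg_eq_0_iff)
  then have "(\<Sum>i\<in>I. f i powr \<alpha> * g i powr \<beta>) = 0"
    by (intro sum.neutral) auto
  then show ?thesis by simp
next
  case False
  define F G where "F = sum f I" and "G = sum g I"
  have FG: "F > 0" "G > 0"
    using False sum_nonneg[of I f] sum_nonneg[of I g] f g unfolding F_def G_def by force+
  have young: "f i powr \<alpha> * g i powr \<beta> \<le> (F powr \<alpha> * G powr \<beta>) * (\<alpha> * (f i / F) + \<beta> * (g i / G))"
    if "i \<in> I" for i
  proof (cases "f i = 0 \<or> g i = 0")
    case True
    then show ?thesis using assms FG f[OF that] g[OF that] by auto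
  next
    case False
    with f[OF that] g[OF that] have pos: "f i > 0" "g i > 0" by auto
    have "(f i / F) powr \<alpha> * (g i / G) powr \<beta> \<le> \<alpha> * (f i / F) + \<beta> * (g i / G)"
      using pos FG assms by (intro Youngs_inequality_0) auto
    with pos FG show ?thesis by (simp add: powr_divide field_simps)
  qed
  have "(\<Sum>i\<in>I. f i powr \<alpha> * g i powr \<beta>)
      \<le> (\<Sum>i\<in>I. (F powr \<alpha> * G powr \<beta>) * (\<alpha> * (f i / F) + \<beta> * (g i / G)))"
    by (rule sum_mono[OF young])
  also have "\<dots> = (F powr \<alpha> * G powr \<beta>) * (\<alpha> * (F / F) + \<beta> * (G / G))"
    by (simp only: sum_distrib_left[symmetric] sum.distrib sum_divide_distrib[symmetric] F_def G_def)
  also have "\<dots> = F powr \<alpha> * G powr \<beta>"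
    using FG assms by simp
  finally show ?thesis unfolding F_def G_def .
qed

text \<open>
  The triangle inequality in \<open>\<ell>\<^sub>r\<close>. With \<open>V i\<close> the row sums and \<open>W\<close> the sum of their \<open>r\<close>-th powers,
  write \<open>V\<^sup>r = V * V\<^sup>r\<^sup>-\<^sup>1\<close>, expand the first factor, and apply Hoelder's inequality for each \<open>j\<close>. This gives
  \<open>W \<le> R * W\<^sup>1\<^sup>-\<^sup>1\<^sup>/\<^sup>r\<close> with \<open>R\<close> the right-hand side, and the power of \<open>W\<close> can be cancelled.
\<close>

lemma Minkowski_sum_powr:
  fixes b :: "'i \<Rightarrow> 'j \<Rightarrow> real"
  assumes "finite I" "finite J" and b: "\<And>i j. i \<in> I \<Longrightarrow> j \<in> J \<Longrightarrow> 0 \<le> b i j" and r: "1 < r"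
  shows "(\<Sum>i\<in>I. (\<Sum>j\<in>J. b i j) powr r) powr (1 / r) \<le> (\<Sum>j\<in>J. (\<Sum>i\<in>I. b i j powr r) powr (1 / r))"
proof -
  define V where "V i = (\<Sum>j\<in>J. b i j)" for i
  define W where "W = (\<Sum>i\<in>I. V i powr r)"
  define R where "R = (\<Sum>j\<in>J. (\<Sum>i\<in>I. b i j powr r) powr (1 / r))"
  have V: "V i \<ge> 0" if "i \<in> I" for i
    unfolding V_def by (intro sum_nonneg b that)
  have W: "W \<ge> 0" unfolding W_def by (simp add: sum_nonneg)
  have R: "R \<ge> 0" unfolding R_def by (simp add: sum_nonneg)
  have col: "(\<Sum>i\<in>I. b i j * V i powr (r - 1))
      \<le> (\<Sum>i\<in>I. b i j powr r) powr (1 / r) * W powr (1 - 1 / r)" if j: "j \<in> J" for j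
  proof -
    have "(\<Sum>i\<in>I. b i j * V i powr (r - 1))
        = (\<Sum>i\<in>I. (b i j powr r) powr (1 / r) * (V i powr r) powr (1 - 1 / r))"
      using r b[OF _ j] V by (intro sum.cong refl) (simp add: powr_powr algebra_simps)
    also have "\<dots> \<le> (\<Sum>i\<in>I. b i j powr r) powr (1 / r) * W powr (1 - 1 / r)"
      unfolding W_def using r assms(1) by (intro Holder_sum_powr) auto
    finally show ?thesis .
  qed
  have "W = (\<Sum>i\<in>I. \<Sum>j\<in>J. b i j * V i powr (r - 1))"
  proof -
    have "V i powr r = V i * V i powr (r - 1)" if "i \<in> I" for i
      using V[OF that] r by (simp add: powr_mult_base)
    then show ?thesis
      unfolding W_def by (auto simp: V_def sum_distrib_right intro!: sum.cong)
  qed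
  also have "\<dots> = (\<Sum>j\<in>J. \<Sum>i\<in>I. b i j * V i powr (r - 1))"
    by (rule sum.swap)
  also have "\<dots> \<le> (\<Sum>j\<in>J. (\<Sum>i\<in>I. b i j powr r) powr (1 / r) * W powr (1 - 1 / r))"
    by (rule sum_mono[OF col])
  finally have le: "W \<le> R * W powr (1 - 1 / r)"
    by (simp add: R_def sum_distrib_right)
  have "W powr (1 / r) \<le> R"
  proof (cases "W = 0")
    case False
    with W have "W > 0" by simp
    moreover have "W powr (1 / r) * W powr (1 - 1 / r) = W"
      using \<open>W > 0\<close> by (simp add: powr_add[symmetric])
    ultimately show ?thesis using le by (metis mult_le_cancel_right_pos powr_gt_zero less_irrefl)
  qed (use R in auto)
  then show ?thesis by (simp add: W_def V_def R_def)
qed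

text \<open>
  Blei's interpolation for two blocks. The exponent \<open>q = 4p/(p+2)\<close> satisfies \<open>2/q = 1/2 + 1/p\<close>. For
  fixed \<open>i\<close>, Hoelder's inequality bounds the sum over \<open>j\<close> by powers of an \<open>\<ell>\<^sub>2\<close>-sum \<open>u i\<close> and an \<open>\<ell>\<^sub>p\<close>-sum
  \<open>v i\<close>; a second use of it over \<open>i\<close> separates these. The factor with \<open>u\<close> is the first hypothesis. In
  the factor with \<open>v\<close> the norms come in the wrong order (first \<open>\<ell>\<^sub>p\<close> in \<open>j\<close>, then \<open>\<ell>\<^sub>2\<close> in \<open>i\<close>);
  since \<open>p < 2\<close>, Minkowski's inequality in \<open>\<ell>\<close> with index \<open>2/p\<close> exchanges them and the second hypothesis
  applies.
\<close>

lemma Blei_two_block: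
  fixes a :: "'i \<Rightarrow> 'j \<Rightarrow> real"
  assumes fin: "finite I" "finite J" and a: "\<And>i j. i \<in> I \<Longrightarrow> j \<in> J \<Longrightarrow> 0 \<le> a i j"
    and p: "0 < p" "p < 2" and D: "0 \<le> D"
    and rows: "(\<Sum>i\<in>I. (\<Sum>j\<in>J. (a i j)\<^sup>2) powr (p / 2)) \<le> D powr p"
    and cols: "(\<Sum>j\<in>J. (\<Sum>i\<in>I. (a i j)\<^sup>2) powr (p / 2)) \<le> D powr p"
  shows "(\<Sum>i\<in>I. \<Sum>j\<in>J. a i j powr (4 * p / (p + 2))) \<le> D powr (4 * p / (p + 2))"
proof -
  define \<alpha> \<beta> where "\<alpha> = p / (p + 2)" and "\<beta> = 2 / (p + 2)"
  have ab: "0 < \<alpha>" "0 < \<beta>" "\<alpha> + \<beta> = 1"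
    using p by (auto simp: \<alpha>_def \<beta>_def add_divide_distrib[symmetric])
  have e1: "2 * \<alpha> + p * \<beta> = 4 * p / (p + 2)"
    by (simp add: \<alpha>_def \<beta>_def add_divide_distrib[symmetric])
  have e2: "p / 2 * \<beta> = \<alpha>" "2 / p * \<alpha> = \<beta>"
    using p by (auto simp: \<alpha>_def \<beta>_def)
  define u v where "u i = (\<Sum>j\<in>J. (a i j)\<^sup>2)" and "v i = (\<Sum>j\<in>J. a i j powr p)" for i
  have uv: "u i \<ge> 0" "v i \<ge> 0" for i
    by (auto simp: u_def v_def sum_nonneg)
  have "(\<Sum>i\<in>I. \<Sum>j\<in>J. a i j powr (4 * p / (p + 2)))
      = (\<Sum>i\<in>I. \<Sum>j\<in>J. ((a i j)\<^sup>2) powr \<alpha> * (a i j powr p) powr \<beta>)"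
  proof (intro sum.cong refl)
    fix i j assume "i \<in> I" "j \<in> J"
    then have "((a i j)\<^sup>2) powr \<alpha> = a i j powr (2 * \<alpha>)"
      using power_powr[of "a i j" 2 \<alpha>] a by simp
    then show "a i j powr (4 * p / (p + 2)) = ((a i j)\<^sup>2) powr \<alpha> * (a i j powr p) powr \<beta>"
      by (simp add: powr_powr powr_add[symmetric] e1)
  qed
  also have "\<dots> \<le> (\<Sum>i\<in>I. u i powr \<alpha> * v i powr \<beta>)"
    unfolding u_def v_def by (intro sum_mono Holder_sum_powr fin ab) auto
  also have "\<dots> = (\<Sum>i\<in>I. (u i powr (p / 2)) powr \<beta> * (v i powr (2 / p)) powr \<alpha>)"
    by (simp only: powr_powr e2)
  also have "\<dots> \<le> (\<Sum>i\<in>I. u i powr (p / 2)) powr \<beta> * (\<Sum>i\<in>I. v i powr (2 / p)) powr \<alpha>"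
    using ab by (intro Holder_sum_powr fin) auto
  also have "\<dots> \<le> (D powr p) powr \<beta> * (D powr 2) powr \<alpha>"
  proof (intro mult_mono powr_mono2)
    have "(\<Sum>i\<in>I. v i powr (2 / p)) powr (1 / (2 / p))
        \<le> (\<Sum>j\<in>J. (\<Sum>i\<in>I. (a i j powr p) powr (2 / p)) powr (1 / (2 / p)))"
      unfolding v_def using p by (intro Minkowski_sum_powr fin) auto
    also have "\<dots> = (\<Sum>j\<in>J. (\<Sum>i\<in>I. (a i j)\<^sup>2) powr (p / 2))"
    proof (intro sum.cong refl arg_cong2[where f = "(powr)"])
      fix i j assume "i \<in> I" "j \<in> J"
      then show "(a i j powr p) powr (2 / p) = (a i j)\<^sup>2"
        using a[of i j] p by (simp add: powr_powr powr_numeral)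
    qed simp
    also note cols
    finally have "((\<Sum>i\<in>I. v i powr (2 / p)) powr (p / 2)) powr (2 / p) \<le> (D powr p) powr (2 / p)"
      using p by (intro powr_mono2) auto
    then show "(\<Sum>i\<in>I. v i powr (2 / p)) \<le> D powr 2"
      using p sum_nonneg[of I "\<lambda>i. v i powr (2 / p)"] by (simp add: powr_powr)
  qed (use ab rows uv in \<open>auto simp: u_def[symmetric] intro!: sum_nonneg\<close>)
  also have "\<dots> = D powr (4 * p / (p + 2))"
    by (simp add: powr_powr powr_add[symmetric] e1[symmetric] add.commute)
  finally show ?thesis .
qed

section \<open>Averages over finite sets\<close>

definition mean :: "'s set \<Rightarrow> ('s \<Rightarrow> real) \<Rightarrow> real" where
  "mean S f = (\<Sum>s\<in>S. f s) / real (card S)"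

text \<open>
  A reverse Hoelder inequality: a function whose fourth moment is controlled by its second moment
  cannot have a small \<open>p\<close>-th moment. It is Hoelder's inequality for \<open>f\<^sup>2 = (f\<^sup>p)\<^sup>\<alpha> (f\<^sup>4)\<^sup>\<beta>\<close>, where
  \<open>\<alpha> + \<beta> = 1\<close> and \<open>p\<alpha> + 4\<beta> = 2\<close>, solved for the \<open>p\<close>-th moment. The exponent of \<open>B\<close>, which is
  \<open>\<beta>/\<alpha> = (2 - p)/2\<close>, tends to \<open>0\<close> as \<open>p\<close> tends to \<open>2\<close>.
\<close>

lemma mean_powr_interpolation:
  fixes f :: "'s \<Rightarrow> real"
  assumes S: "finite S" "S \<noteq> {}" and f: "\<And>s. s \<in> S \<Longrightarrow> 0 \<le> f s" and p: "0 < p" "p < 2"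
    and B: "0 \<le> B" and second: "mean S (\<lambda>s. (f s)\<^sup>2) = V" and fourth: "mean S (\<lambda>s. f s ^ 4) \<le> B * V\<^sup>2"
  shows "V powr (p / 2) \<le> B powr ((2 - p) / 2) * mean S (\<lambda>s. f s powr p)"
proof (cases "V = 0")
  case True
  have "0 \<le> mean S (\<lambda>s. f s powr p)" by (simp add: mean_def sum_nonneg)
  then show ?thesis using True by simp
next
  case False
  define \<alpha> \<beta> where "\<alpha> = 2 / (4 - p)" and "\<beta> = (2 - p) / (4 - p)"
  define m where "m = mean S (\<lambda>s. f s powr p)"
  define c where "c = real (card S)"
  have c: "c > 0" using S by (simp add: c_def card_gt_0_iff)
  have m: "m \<ge> 0" by (simp add: m_def mean_def sum_nonneg)
  have "V \<ge> 0" unfolding second[symmetric] mean_def by (simp add: sum_nonneg)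
  with False have V: "V > 0" by simp
  have "p * \<alpha> + 4 * \<beta> = (p * 2 + 4 * (2 - p)) / (4 - p)"
    by (simp only: \<alpha>_def \<beta>_def add_divide_distrib times_divide_eq_right)
  also have "\<dots> = 2" using p by (simp add: divide_eq_eq)
  finally have ab: "0 < \<alpha>" "0 < \<beta>" "\<alpha> + \<beta> = 1" "p * \<alpha> + 4 * \<beta> = 2"
    using p by (auto simp: \<alpha>_def \<beta>_def add_divide_distrib[symmetric])
  have "c * V = (\<Sum>s\<in>S. (f s)\<^sup>2)"
    using second c by (auto simp: mean_def c_def)
  also have "\<dots> = (\<Sum>s\<in>S. (f s powr p) powr \<alpha> * (f s ^ 4) powr \<beta>)"
  proof (intro sum.cong refl)
    fix s assume "s \<in> S"
    then have "f s \<ge> 0" by (rule f)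
    moreover from this have "(f s ^ 4) powr \<beta> = f s powr (4 * \<beta>)"
      using power_powr[of "f s" 4 \<beta>] by simp
    ultimately show "(f s)\<^sup>2 = (f s powr p) powr \<alpha> * (f s ^ 4) powr \<beta>"
      by (simp add: powr_powr powr_add[symmetric] ab powr_numeral)
  qed
  also have "\<dots> \<le> (\<Sum>s\<in>S. f s powr p) powr \<alpha> * (\<Sum>s\<in>S. f s ^ 4) powr \<beta>"
    using ab S by (intro Holder_sum_powr) auto
  also have "\<dots> = (c * m) powr \<alpha> * (c * mean S (\<lambda>s. f s ^ 4)) powr \<beta>"
    using c by (simp add: m_def mean_def c_def)
  also have "\<dots> \<le> (c * m) powr \<alpha> * (c * (B * V\<^sup>2)) powr \<beta>"
    using fourth c ab by (intro mult_left_mono powr_mono2 mult_nonneg_nonneg) (auto simp: mean_def sum_nonneg)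
  also have "\<dots> = c * (m powr \<alpha> * (B powr \<beta> * V powr (2 * \<beta>)))"
  proof -
    have "c powr \<alpha> * c powr \<beta> = c" using c ab by (simp add: powr_add[symmetric])
    moreover have "(V\<^sup>2) powr \<beta> = V powr (2 * \<beta>)"
      using power_powr[of V 2 \<beta>] V by simp
    ultimately show ?thesis using c m B V by (simp add: powr_mult ac_simps)
  qed
  finally have "V \<le> m powr \<alpha> * (B powr \<beta> * V powr (2 * \<beta>))"
    using c by simp
  then have "V powr (1 - 2 * \<beta>) \<le> m powr \<alpha> * B powr \<beta>"
    using V by (simp add: powr_diff field_simps)
  then have "(V powr (1 - 2 * \<beta>)) powr (1 / \<alpha>) \<le> (m powr \<alpha> * B powr \<beta>) powr (1 / \<alpha>)"
    using ab V by (intro powr_mono2) auto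
  moreover have "(1 - 2 * \<beta>) * (1 / \<alpha>) = p / 2" "\<beta> * (1 / \<alpha>) = (2 - p) / 2"
    using p by (auto simp: \<alpha>_def \<beta>_def field_simps)
  then have "(V powr (1 - 2 * \<beta>)) powr (1 / \<alpha>) = V powr (p / 2)"
    and "(m powr \<alpha> * B powr \<beta>) powr (1 / \<alpha>) = m * B powr ((2 - p) / 2)"
    using m ab B by (simp_all only: powr_mult powr_powr) auto
  ultimately show ?thesis by (simp add: m_def mult.commute)
qed

section \<open>Sums over multi-indices\<close>

lemma sum_PiE_insert:
  assumes "finite K" "k \<notin> K"
  shows "(\<Sum>i\<in>PiE (insert k K) (\<lambda>_. I). F i) = (\<Sum>x\<in>I. \<Sum>g\<in>PiE K (\<lambda>_. I). F (g(k := x)))"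
proof -
  have inj: "inj_on (\<lambda>(x, g). g(k := x)) (I \<times> PiE K (\<lambda>_. I))"
    using assms by (intro inj_combinator)
  have "(\<Sum>i\<in>PiE (insert k K) (\<lambda>_. I). F i) = (\<Sum>(x, g)\<in>I \<times> PiE K (\<lambda>_. I). F (g(k := x)))"
    unfolding PiE_insert_eq by (subst sum.reindex[OF inj]) (simp add: case_prod_unfold o_def)
  then show ?thesis by (simp add: sum.cartesian_product)
qed

definition merge :: "'k set \<Rightarrow> ('k \<Rightarrow> 'i) \<Rightarrow> ('k \<Rightarrow> 'i) \<Rightarrow> 'k \<Rightarrow> 'i" where
  "merge A i j = (\<lambda>k. if k \<in> A then i k else j k)"

lemma sum_PiE_union:
  assumes "A \<inter> B = {}"
  shows "(\<Sum>h\<in>PiE (A \<union> B) (\<lambda>_. I). F h) =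
    (\<Sum>i\<in>PiE A (\<lambda>_. I). \<Sum>j\<in>PiE B (\<lambda>_. I). F (merge A i j))"
proof -
  have "(\<Sum>h\<in>PiE (A \<union> B) (\<lambda>_. I). F h)
      = (\<Sum>(i, j)\<in>PiE A (\<lambda>_. I) \<times> PiE B (\<lambda>_. I). F (merge A i j))"
    by (rule sum.reindex_bij_witness[of _ "\<lambda>(i, j). merge A i j" "\<lambda>h. (restrict h A, restrict h B)"])
       (use assms in \<open>auto simp: merge_def PiE_def extensional_def Pi_def restrict_def fun_eq_iff
          intro!: arg_cong[where f = F] split: if_splits\<close>)
  then show ?thesis by (simp add: sum.cartesian_product)
qed

section \<open>Moments of random sign sums\<close>

lemma mean_PiE_insert:
  assumes "finite K" "k \<notin> K"
  shows "mean (PiE (insert k K) (\<lambda>_. X)) F = mean X (\<lambda>x. mean (PiE K (\<lambda>_. X)) (\<lambda>g. F (g(k := x))))"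
  using assms by (simp add: mean_def sum_PiE_insert card_PiE sum_divide_distrib ac_simps)

lemma mean_mono: "(\<And>s. s \<in> S \<Longrightarrow> f s \<le> g s) \<Longrightarrow> mean S f \<le> mean S g"
  by (simp add: mean_def divide_right_mono sum_mono)

lemma mean_sum: "mean S (\<lambda>s. \<Sum>i\<in>I. f i s) = (\<Sum>i\<in>I. mean S (f i))"
  unfolding mean_def by (subst sum.swap) (simp add: sum_divide_distrib)

lemma mean_mult: "mean S (\<lambda>s. c * f s) = c * mean S f"
  by (simp add: mean_def sum_distrib_left)

lemma mean_le_const: "\<lbrakk>\<And>s. s \<in> S \<Longrightarrow> f s \<le> c; 0 \<le> c\<rbrakk> \<Longrightarrow> mean S f \<le> c"
  using sum_bounded_above[of S f c]
  by (cases "card S = 0") (auto simp: mean_def divide_le_eq mult.commute)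

lemma mean_add: "mean S (\<lambda>s. f s + g s) = mean S f + mean S g"
  by (simp add: mean_def sum.distrib add_divide_distrib)

lemma mean_const: "finite S \<Longrightarrow> S \<noteq> {} \<Longrightarrow> mean S (\<lambda>_. c) = c"
  by (simp add: mean_def)

abbreviation signs :: "'i set \<Rightarrow> ('i \<Rightarrow> real) set" where
  "signs I \<equiv> PiE I (\<lambda>_. {-1, 1})"

lemma finite_signs: "finite I \<Longrightarrow> finite (signs I)"
  by (simp add: finite_PiE)

lemma signs_nonempty: "signs I \<noteq> {}"
  by (simp add: PiE_eq_empty_iff)

lemma mean_signs_insert:
  assumes "finite I" "k \<notin> I"
  shows "mean (signs (insert k I)) F = mean (signs I) (\<lambda>e. (F (e(k := -1)) + F (e(k := 1))) / 2)"
  using assms by (simp add: mean_PiE_insert) (simp add: mean_def sum.distrib add_divide_distrib sum_divide_distrib ac_simps)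

text \<open>
  The effect of one more random sign on a family of vectors \<open>f t\<close>, to which \<open>\<plusminus> b t\<close> is added. The
  cross term \<open>R\<close> cancels in the first average; in the average of the squares it contributes \<open>4R\<^sup>2\<close>,
  at most \<open>4SB\<close> by Cauchy--Schwarz.
\<close>

lemma rademacher_step:
  fixes f b :: "'t \<Rightarrow> 'a::real_inner"
  assumes "finite T"
  defines "S \<equiv> \<Sum>t\<in>T. (norm (f t))\<^sup>2" and "B \<equiv> \<Sum>t\<in>T. (norm (b t))\<^sup>2"
  defines "P \<equiv> \<Sum>t\<in>T. (norm (b t + f t))\<^sup>2" and "M \<equiv> \<Sum>t\<in>T. (norm (- b t + f t))\<^sup>2"
  shows "(P + M) / 2 = S + B" and "(P\<^sup>2 + M\<^sup>2) / 2 \<le> S\<^sup>2 + 6 * B * S + B\<^sup>2"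
proof -
  define R where "R = (\<Sum>t\<in>T. inner (f t) (b t))"
  have P: "P = S + B + 2 * R" and M: "M = S + B - 2 * R"
    unfolding P_def M_def S_def B_def R_def
    by (simp_all add: power2_norm_eq_inner inner_simps inner_commute sum.distrib sum_subtractf sum_distrib_left algebra_simps)
  show "(P + M) / 2 = S + B" by (simp add: P M)
  have "R\<^sup>2 \<le> (\<Sum>t\<in>T. norm (f t) * norm (b t))\<^sup>2"
    unfolding R_def by (rule power2_le_iff_abs_le[THEN iffD2])
      (auto intro!: sum_nonneg order_trans[OF sum_abs] sum_mono Cauchy_Schwarz_ineq2)
  also have "\<dots> \<le> S * B"
    unfolding S_def B_def by (rule Cauchy_Schwarz_ineq_sum)
  finally have "R\<^sup>2 \<le> S * B" .
  then show "(P\<^sup>2 + M\<^sup>2) / 2 \<le> S\<^sup>2 + 6 * B * S + B\<^sup>2"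
    by (simp add: P M power2_eq_square algebra_simps)
qed

text \<open>
  With \<open>\<sigma>\<close> the value of the second moment, one more sign turns the bound \<open>3\<sigma>\<^sup>2\<close> into
  \<open>3\<sigma>\<^sup>2 + 6B\<sigma> + B\<^sup>2 \<le> 3(\<sigma> + B)\<^sup>2\<close>. A family indexed by \<open>t\<close> is treated, and not a single vector,
  because the passage from \<open>n\<close> to \<open>n + 1\<close> sign vectors applies this to all the coefficients
  that remain after one slot has been filled.
\<close>

lemma rademacher_moments:
  fixes a :: "'i \<Rightarrow> 't \<Rightarrow> 'a::real_inner"
  assumes "finite I" "finite T"
  defines "Q \<equiv> \<lambda>I e. \<Sum>t\<in>T. (norm (\<Sum>i\<in>I. e i *\<^sub>R a i t))\<^sup>2"
  shows "mean (signs I) (Q I) = (\<Sum>t\<in>T. \<Sum>i\<in>I. (norm (a i t))\<^sup>2)" (is "?second I")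
    and "mean (signs I) (\<lambda>e. (Q I e)\<^sup>2) \<le> 3 * (\<Sum>t\<in>T. \<Sum>i\<in>I. (norm (a i t))\<^sup>2)\<^sup>2" (is "?fourth I")
proof -
  have "?second I \<and> ?fourth I"
    using assms(1)
  proof (induction I)
    case empty
    then show ?case by (simp add: mean_def Q_def)
  next
    case (insert k I)
    define \<sigma> where "\<sigma> = (\<Sum>t\<in>T. \<Sum>i\<in>I. (norm (a i t))\<^sup>2)"
    define B where "B = (\<Sum>t\<in>T. (norm (a k t))\<^sup>2)"
    have B: "B \<ge> 0" by (simp add: B_def sum_nonneg)
    have Q1: "Q (insert k I) (e(k := x)) = (\<Sum>t\<in>T. (norm (x *\<^sub>R a k t + (\<Sum>i\<in>I. e i *\<^sub>R a i t)))\<^sup>2)" for e x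
    proof -
      have "(\<Sum>i\<in>I. (e(k := x)) i *\<^sub>R a i t) = (\<Sum>i\<in>I. e i *\<^sub>R a i t)" for t
        using insert.hyps by (intro sum.cong) auto
      then show ?thesis unfolding Q_def using insert.hyps by simp
    qed
    note step = rademacher_step[OF assms(2), where b = "a k" and f = "\<lambda>t. \<Sum>i\<in>I. e i *\<^sub>R a i t" for e,
        folded B_def]
    have two: "(Q (insert k I) (e(k := -1)) + Q (insert k I) (e(k := 1))) / 2 = Q I e + B" for e
      using step(1)[of e] unfolding Q1 by (simp add: Q_def add.commute)
    have four: "((Q (insert k I) (e(k := -1)))\<^sup>2 + (Q (insert k I) (e(k := 1)))\<^sup>2) / 2
        \<le> (Q I e)\<^sup>2 + 6 * B * Q I e + B\<^sup>2" for e
      using step(2)[of e] unfolding Q1 by (simp add: Q_def add.commute)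
    have new: "(\<Sum>t\<in>T. \<Sum>i\<in>insert k I. (norm (a i t))\<^sup>2) = \<sigma> + B"
      using insert.hyps by (simp add: sum.distrib \<sigma>_def B_def)
    have "mean (signs (insert k I)) (Q (insert k I)) = \<sigma> + B"
      using insert by (simp add: mean_signs_insert two mean_add mean_const finite_signs signs_nonempty \<sigma>_def)
    moreover have "mean (signs (insert k I)) (\<lambda>e. (Q (insert k I) e)\<^sup>2) \<le> 3 * (\<sigma> + B)\<^sup>2"
    proof -
      have "mean (signs (insert k I)) (\<lambda>e. (Q (insert k I) e)\<^sup>2)
          \<le> mean (signs I) (\<lambda>e. (Q I e)\<^sup>2 + 6 * B * Q I e + B\<^sup>2)"
        unfolding mean_signs_insert[OF insert.hyps] by (intro mean_mono four)
      also have "\<dots> = mean (signs I) (\<lambda>e. (Q I e)\<^sup>2) + 6 * B * \<sigma> + B\<^sup>2"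
        using insert by (simp add: mean_add mean_mult mean_const finite_signs signs_nonempty \<sigma>_def)
      also have "\<dots> \<le> 3 * \<sigma>\<^sup>2 + 6 * B * \<sigma> + B\<^sup>2"
        using insert.IH by (simp add: \<sigma>_def)
      also have "\<dots> \<le> 3 * (\<sigma> + B)\<^sup>2"
        by (simp add: power2_eq_square algebra_simps)
      finally show ?thesis .
    qed
    ultimately show ?case unfolding new by simp
  qed
  then show "?second I" "?fourth I" by auto
qed

text \<open>
  The decoupled Rademacher chaos: the value of the multilinear map with coefficient array \<open>a\<close> when
  independent sign vectors \<open>s k\<close> are put in its slots \<open>k \<in> K\<close>.
\<close>

definition chaos :: "'k set \<Rightarrow> 'i set \<Rightarrow> (('k \<Rightarrow> 'i) \<Rightarrow> 'a::real_vector) \<Rightarrow> ('k \<Rightarrow> 'i \<Rightarrow> real) \<Rightarrow> 'a" where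
  "chaos K I a s = (\<Sum>i\<in>PiE K (\<lambda>_. I). (\<Prod>k\<in>K. s k (i k)) *\<^sub>R a i)"

lemma chaos_insert:
  assumes "finite K" "k \<notin> K"
  shows "chaos (insert k K) I a (s(k := e)) = chaos K I (\<lambda>i. \<Sum>x\<in>I. e x *\<^sub>R a (i(k := x))) s"
proof -
  have prod: "(\<Prod>l\<in>insert k K. (s(k := e)) l ((g(k := x)) l)) = e x * (\<Prod>l\<in>K. s l (g l))" for g x
  proof -
    have "(\<Prod>l\<in>K. (s(k := e)) l ((g(k := x)) l)) = (\<Prod>l\<in>K. s l (g l))"
      using assms by (intro prod.cong) auto
    then show ?thesis using assms by simp
  qed
  show ?thesis
    unfolding chaos_def sum_PiE_insert[OF assms] prod scaleR_sum_right
    by (subst sum.swap) (simp add: mult.commute)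
qed

text \<open>
  Induction on the number of slots, fixing the signs \<open>e\<close> of the new slot \<open>k\<close>. What remains is a chaos
  over \<open>K\<close> with coefficients \<open>b e i\<close>, whose moments the induction hypothesis controls by
  \<open>Q e\<close>, the sum of the squared norms of these. Averaging \<open>Q\<close> and \<open>Q\<^sup>2\<close> over \<open>e\<close> is the case of one
  sign vector for the family \<open>b e i\<close>, and costs one factor \<open>3\<close>.
\<close>

lemma chaos_moments:
  fixes a :: "('k \<Rightarrow> 'i) \<Rightarrow> 'a::real_inner"
  assumes "finite K" "finite I"
  shows "mean (PiE K (\<lambda>_. signs I)) (\<lambda>s. (norm (chaos K I a s))\<^sup>2) = (\<Sum>i\<in>PiE K (\<lambda>_. I). (norm (a i))\<^sup>2)"
      (is "?second K a")
    and "mean (PiE K (\<lambda>_. signs I)) (\<lambda>s. norm (chaos K I a s) ^ 4)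
      \<le> 3 ^ card K * (\<Sum>i\<in>PiE K (\<lambda>_. I). (norm (a i))\<^sup>2)\<^sup>2" (is "?fourth K a")
proof -
  have "?second K a \<and> ?fourth K a" using assms(1)
  proof (induction K arbitrary: a)
    case empty
    show ?case by (simp add: mean_def chaos_def)
  next
    case (insert k K)
    define b where "b e i = (\<Sum>x\<in>I. e x *\<^sub>R a (i(k := x)))" for e i
    define Q where "Q e = (\<Sum>i\<in>PiE K (\<lambda>_. I). (norm (b e i))\<^sup>2)" for e
    note ins = mean_PiE_insert[OF insert.hyps] chaos_insert[OF insert.hyps, of I a, folded b_def]
    have fin: "finite (PiE K (\<lambda>_. I))" using insert.hyps assms(2) by (simp add: finite_PiE)
    note rad = rademacher_moments[OF assms(2) fin, of "\<lambda>x i. a (i(k := x))", folded b_def, folded Q_def]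
    have total: "(\<Sum>i\<in>PiE (insert k K) (\<lambda>_. I). (norm (a i))\<^sup>2)
        = (\<Sum>i\<in>PiE K (\<lambda>_. I). \<Sum>x\<in>I. (norm (a (i(k := x))))\<^sup>2)"
      using insert.hyps by (subst sum_PiE_insert, simp, simp) (rule sum.swap)
    have "?second (insert k K) a"
      using insert.IH rad(1) by (simp add: ins total Q_def)
    moreover have "?fourth (insert k K) a"
    proof -
      have "mean (PiE (insert k K) (\<lambda>_. signs I)) (\<lambda>s. norm (chaos (insert k K) I a s) ^ 4)
          \<le> mean (signs I) (\<lambda>e. 3 ^ card K * (Q e)\<^sup>2)"
        unfolding ins Q_def using insert.IH by (intro mean_mono) blast
      also have "\<dots> \<le> 3 ^ card (insert k K) * (\<Sum>i\<in>PiE (insert k K) (\<lambda>_. I). (norm (a i))\<^sup>2)\<^sup>2"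
        using rad(2) insert.hyps by (simp add: mean_mult total)
      finally show ?thesis .
    qed
    ultimately show ?case ..
  qed
  then show "?second K a" "?fourth K a" by auto
qed

definition BH_exp :: "nat \<Rightarrow> real" where
  "BH_exp n = 2 * real n / (real n + 1)"

text \<open>
  Here \<open>p = 2n/(n+1)\<close> with \<open>n\<close> the number of slots, so \<open>2 - p = 2/(n+1)\<close> and the factor \<open>3\<^sup>n\<close> in the
  fourth moment is raised to the power \<open>(2 - p)/2 = p/(2n)\<close>. The constant \<open>\<surd>3\<close> thus does not depend
  on \<open>n\<close>.
\<close>

lemma chaos_Khinchine:
  fixes a :: "('k \<Rightarrow> 'i) \<Rightarrow> 'a::real_inner"
  assumes "finite K" "finite I" "K \<noteq> {}"
  defines "p \<equiv> BH_exp (card K)"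
  shows "(\<Sum>i\<in>PiE K (\<lambda>_. I). (norm (a i))\<^sup>2) powr (p / 2)
    \<le> sqrt 3 powr p * mean (PiE K (\<lambda>_. signs I)) (\<lambda>s. norm (chaos K I a s) powr p)"
proof -
  have n: "card K > 0" using assms by (simp add: card_gt_0_iff)
  have p: "0 < p" "p < 2" using n by (auto simp: p_def BH_exp_def field_simps)
  have "real (card K) * ((2 - p) / 2) = 1 / 2 * p"
    by (simp add: p_def BH_exp_def field_simps)
  then have B: "(3 ^ card K) powr ((2 - p) / 2) = sqrt 3 powr p"
    using power_powr[of 3 "card K" "(2 - p) / 2"] n
    by (simp only: powr_powr[symmetric]) (simp add: powr_half_sqrt)
  have "(\<Sum>i\<in>PiE K (\<lambda>_. I). (norm (a i))\<^sup>2) powr (p / 2)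
      \<le> (3 ^ card K) powr ((2 - p) / 2) * mean (PiE K (\<lambda>_. signs I)) (\<lambda>s. norm (chaos K I a s) powr p)"
    using assms(1,2) p
    by (intro mean_powr_interpolation chaos_moments) (auto simp: finite_PiE PiE_eq_empty_iff)
  then show ?thesis by (simp only: B)
qed

section \<open>The inequality for coefficient arrays\<close>

definition form :: "'k set \<Rightarrow> 'i set \<Rightarrow> (('k \<Rightarrow> 'i) \<Rightarrow> 'a::comm_ring_1) \<Rightarrow> ('k \<Rightarrow> 'i \<Rightarrow> 'a) \<Rightarrow> 'a" where
  "form K I a z = (\<Sum>i\<in>PiE K (\<lambda>_. I). (\<Prod>k\<in>K. z k (i k)) * a i)"

definition bounded_form :: "'k set \<Rightarrow> 'i set \<Rightarrow> (('k \<Rightarrow> 'i) \<Rightarrow> 'a::real_normed_field) \<Rightarrow> real \<Rightarrow> bool"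
  where "bounded_form K I a L \<longleftrightarrow>
    (\<forall>z. (\<forall>k i. norm (z k i) \<le> 1) \<longrightarrow> norm (form K I a z) \<le> L)"

text \<open>
  The inequality for a form given by its coefficients. The slots are an arbitrary \<open>n\<close>-element set \<open>K\<close>
  rather than \<open>{..<n}\<close>, so that \<open>n\<close> of the slots of a larger form can be used without renumbering.
  Any bound \<open>L\<close> replaces the supremum, and the closed polydisc replaces the open one, so that
  sign vectors can be inserted directly.
\<close>

definition array_BH :: "'a::real_normed_field itself \<Rightarrow> nat \<Rightarrow> real \<Rightarrow> bool" where
  "array_BH (_ :: 'a itself) n C \<longleftrightarrow>
    (\<forall>(K :: nat set) (I :: nat set) (a :: (nat \<Rightarrow> nat) \<Rightarrow> 'a) L.
      finite K \<longrightarrow> card K = n \<longrightarrow> finite I \<longrightarrow> bounded_form K I a L \<longrightarrow>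
      (\<Sum>i\<in>PiE K (\<lambda>_. I). norm (a i) powr BH_exp n) \<le> (C * L) powr BH_exp n)"

lemma bounded_form_nonneg: "bounded_form K I a L \<Longrightarrow> 0 \<le> L"
  unfolding bounded_form_def
  by (rule order_trans[OF norm_ge_zero]) (auto dest: spec[of _ "\<lambda>_ _. 0"])

text \<open>
  The exponent is \<open>1\<close>, and a linear form attains the sum of the norms of its coefficients at the
  vector of their inverse phases \<open>sg\<close>.
\<close>

lemma array_BH_one: "array_BH TYPE('a::real_normed_field) 1 1"
  unfolding array_BH_def
proof (intro allI impI)
  fix K I :: "nat set" and a :: "(nat \<Rightarrow> nat) \<Rightarrow> 'a" and L
  assume "finite K" "card K = 1" and I: "finite I" and L: "bounded_form K I a L"
  then obtain k where K: "K = {k}" by (auto simp: card_1_singleton_iff)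
  define sg :: "'a \<Rightarrow> 'a" where "sg u = (if u = 0 then 0 else of_real (norm u) / u)" for u
  have sg: "norm (sg u) \<le> 1" "sg u * u = of_real (norm u)" for u
    by (auto simp: sg_def norm_divide)
  have "form K I a (\<lambda>_ j. sg (a (\<lambda>_\<in>{k}. j))) = (\<Sum>i\<in>PiE K (\<lambda>_. I). of_real (norm (a i)))"
    unfolding form_def
  proof (intro sum.cong refl)
    fix i assume "i \<in> PiE K (\<lambda>_. I)"
    then have "(\<lambda>_\<in>{k}. i k) = i"
      by (auto simp: K PiE_def extensional_def restrict_def fun_eq_iff)
    then show "(\<Prod>l\<in>K. sg (a (\<lambda>_\<in>{k}. i l))) * a i = of_real (norm (a i))"
      by (simp add: K sg)
  qed
  then have "norm (of_real (\<Sum>i\<in>PiE K (\<lambda>_. I). norm (a i)) :: 'a) \<le> L"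
    using L[unfolded bounded_form_def, rule_format, of "\<lambda>_ j. sg (a (\<lambda>_\<in>{k}. j))"] sg(1)
    by (simp only: of_real_sum)
  then have "(\<Sum>i\<in>PiE K (\<lambda>_. I). norm (a i)) \<le> L"
    unfolding norm_of_real by (simp add: sum_nonneg)
  moreover have "0 \<le> L" using L by (rule bounded_form_nonneg)
  ultimately show "(\<Sum>i\<in>PiE K (\<lambda>_. I). norm (a i) powr BH_exp 1) \<le> (1 * L) powr BH_exp 1"
    by (simp add: BH_exp_def sum_nonneg)
qed

text \<open>
  Putting the signs \<open>s\<close> in the slots of \<open>B\<close> can be read in two ways: as a chaos for each coefficient
  of a form in the slots of \<open>A\<close>, or as evaluating the whole form at a particular point.
\<close>

lemma form_randomised:
  fixes a :: "('k \<Rightarrow> 'i) \<Rightarrow> 'a::real_normed_field"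
  assumes "finite A" "finite B" "A \<inter> B = {}"
  shows "form A I (\<lambda>i. chaos B I (\<lambda>j. a (merge A i j)) s) z
      = form (A \<union> B) I a (\<lambda>k x. if k \<in> A then z k x else of_real (s k x))"
proof -
  have "(\<Prod>k\<in>A \<union> B. if k \<in> A then z k (merge A i j k) else of_real (s k (merge A i j k)))
      = (\<Prod>k\<in>A. z k (i k)) * of_real (\<Prod>k\<in>B. s k (j k))" for i j
  proof -
    have "(\<Prod>k\<in>A. if k \<in> A then z k (merge A i j k) else of_real (s k (merge A i j k)))
        = (\<Prod>k\<in>A. z k (i k))"
      by (intro prod.cong) (auto simp: merge_def)
    moreover have "(\<Prod>k\<in>B. if k \<in> A then z k (merge A i j k) else of_real (s k (merge A i j k)))
        = (\<Prod>k\<in>B. of_real (s k (j k)))"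
      using assms(3) by (intro prod.cong) (auto simp: merge_def)
    ultimately show ?thesis
      unfolding prod.union_disjoint[OF assms] by (simp add: of_real_prod)
  qed
  then show ?thesis
    unfolding form_def sum_PiE_union[OF assms(3)]
    by (simp add: chaos_def sum_distrib_left scaleR_conv_of_real mult.assoc)
qed

text \<open>
  For each choice of signs in \<open>B\<close>, the inequality of order \<open>n\<close> holds for the remaining form in the
  slots of \<open>A\<close>. Its average over the signs is bounded below, for each \<open>i\<close>, by
  the Khinchine inequality in the slots of \<open>B\<close>.
\<close>

lemma array_BH_mixed:
  fixes a :: "(nat \<Rightarrow> nat) \<Rightarrow> 'a::{real_normed_field, real_inner}"
  assumes BH: "array_BH TYPE('a) n C" and n: "n > 0" and C: "C \<ge> 0"
    and A: "finite A" "card A = n" and B: "finite B" "card B = n" and AB: "A \<inter> B = {}"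
    and I: "finite I" and L: "bounded_form (A \<union> B) I a L"
  shows "(\<Sum>i\<in>PiE A (\<lambda>_. I). (\<Sum>j\<in>PiE B (\<lambda>_. I). (norm (a (merge A i j)))\<^sup>2) powr (BH_exp n / 2))
    \<le> (sqrt 3 * C * L) powr BH_exp n"
proof -
  let ?p = "BH_exp n" and ?S = "PiE B (\<lambda>_. signs I)"
  let ?f = "\<lambda>s i. chaos B I (\<lambda>j. a (merge A i j)) s"
  have L0: "L \<ge> 0" using L by (rule bounded_form_nonneg)
  have slice: "(\<Sum>i\<in>PiE A (\<lambda>_. I). norm (?f s i) powr ?p) \<le> (C * L) powr ?p" if s: "s \<in> ?S" for s
  proof -
    have "bounded_form A I (?f s) L"
      unfolding bounded_form_def
    proof (intro allI impI)
      fix z :: "nat \<Rightarrow> nat \<Rightarrow> 'a" assume z: "\<forall>k i. norm (z k i) \<le> 1"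
      \<comment> \<open>An extensional sign vector has the value \<open>undefined\<close> outside its domain; it is set to \<open>0\<close>
        there to obtain a point of the polydisc.\<close>
      define s' where "s' k x = (if k \<in> B \<and> x \<in> I then s k x else 0)" for k x
      have s': "\<bar>s' k x\<bar> \<le> 1" for k x
        using PiE_mem[OF PiE_mem[OF s], of k x] by (auto simp: s'_def)
      have "?f s i = ?f s' i" for i
        unfolding chaos_def s'_def
        by (intro sum.cong refl arg_cong2[where f = "(*\<^sub>R)"] prod.cong) (auto simp: PiE_mem)
      then have "form A I (?f s) z
          = form (A \<union> B) I a (\<lambda>k x. if k \<in> A then z k x else of_real (s' k x))"
        using form_randomised[OF A(1) B(1) AB, of I a s' z] by simp
      moreover have "norm (if k \<in> A then z k x else of_real (s' k x)) \<le> 1" for k x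
        using z s' by simp
      ultimately show "norm (form A I (?f s) z) \<le> L"
        using L[unfolded bounded_form_def, rule_format,
            of "\<lambda>k x. if k \<in> A then z k x else of_real (s' k x)"]
        by (simp only:)
    qed
    with BH A I show ?thesis unfolding array_BH_def by blast
  qed
  have "(\<Sum>i\<in>PiE A (\<lambda>_. I). (\<Sum>j\<in>PiE B (\<lambda>_. I). (norm (a (merge A i j)))\<^sup>2) powr (?p / 2))
      \<le> (\<Sum>i\<in>PiE A (\<lambda>_. I). sqrt 3 powr ?p * mean ?S (\<lambda>s. norm (?f s i) powr ?p))"
    using chaos_Khinchine[OF B(1) I] B n by (intro sum_mono) fastforce
  also have "\<dots> = sqrt 3 powr ?p * mean ?S (\<lambda>s. \<Sum>i\<in>PiE A (\<lambda>_. I). norm (?f s i) powr ?p)"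
    by (simp add: mean_sum sum_distrib_left)
  also have "\<dots> \<le> sqrt 3 powr ?p * (C * L) powr ?p"
    by (intro mult_left_mono mean_le_const slice) auto
  also have "\<dots> = (sqrt 3 * C * L) powr ?p"
    using C L0 by (simp add: powr_mult)
  finally show ?thesis .
qed

text \<open>
  The two mixed-norm estimates, for the slots split into halves \<open>A\<close> and \<open>B\<close> and for the roles of
  these exchanged, are the two hypotheses of Blei's interpolation, whose exponent is the one
  belonging to \<open>2n\<close>.
\<close>

lemma array_BH_double:
  assumes BH: "array_BH TYPE('a::{real_normed_field, real_inner}) n C" and n: "n > 0" and C: "C \<ge> 0"
  shows "array_BH TYPE('a) (2 * n) (sqrt 3 * C)"
  unfolding array_BH_def
proof (intro allI impI)
  fix K I :: "nat set" and a :: "(nat \<Rightarrow> nat) \<Rightarrow> 'a" and L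
  assume K: "finite K" "card K = 2 * n" and I: "finite I" and L: "bounded_form K I a L"
  obtain A where A: "A \<subseteq> K" "card A = n" "finite A"
    using obtain_subset_with_card_n[of n K] K by auto
  define B where "B = K - A"
  have AB: "A \<inter> B = {}" "A \<union> B = K" using A by (auto simp: B_def)
  have B: "finite B" "card B = n" using A K by (auto simp: B_def card_Diff_subset)
  have L0: "L \<ge> 0" using L by (rule bounded_form_nonneg)
  define p where "p = BH_exp n"
  have p: "0 < p" "p < 2" using n by (auto simp: p_def BH_exp_def field_simps)
  have q: "BH_exp (2 * n) = 4 * p / (p + 2)"
  proof -
    have num: "4 * p = 8 * real n / (real n + 1)" and den: "p + 2 = (4 * real n + 2) / (real n + 1)"
      by (auto simp: p_def BH_exp_def field_simps)
    have "BH_exp (2 * n) * (p + 2) = 4 * p"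
      unfolding num den BH_exp_def by (simp add: divide_simps)
    then show ?thesis using p by (simp add: eq_divide_eq)
  qed
  have rows: "(\<Sum>i\<in>PiE A (\<lambda>_. I). (\<Sum>j\<in>PiE B (\<lambda>_. I). (norm (a (merge A i j)))\<^sup>2) powr (p / 2))
      \<le> (sqrt 3 * C * L) powr p"
    unfolding p_def using A B AB L by (intro array_BH_mixed BH n C I) auto
  have "merge B j i = merge A i j" if "i \<in> PiE A (\<lambda>_. I)" "j \<in> PiE B (\<lambda>_. I)" for i j
    using that AB by (auto simp: merge_def fun_eq_iff PiE_def extensional_def)
  then have "(\<Sum>j\<in>PiE B (\<lambda>_. I). (\<Sum>i\<in>PiE A (\<lambda>_. I). (norm (a (merge A i j)))\<^sup>2) powr (p / 2))
      = (\<Sum>j\<in>PiE B (\<lambda>_. I). (\<Sum>i\<in>PiE A (\<lambda>_. I). (norm (a (merge B j i)))\<^sup>2) powr (p / 2))"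
    by (intro sum.cong refl arg_cong2[where f = "(powr)"]) simp
  also have "\<dots> \<le> (sqrt 3 * C * L) powr p"
    unfolding p_def using A B AB L by (intro array_BH_mixed BH n C I) (auto simp: Un_commute)
  finally have cols: "(\<Sum>j\<in>PiE B (\<lambda>_. I). (\<Sum>i\<in>PiE A (\<lambda>_. I). (norm (a (merge A i j)))\<^sup>2) powr (p / 2))
      \<le> (sqrt 3 * C * L) powr p" .
  have "(\<Sum>i\<in>PiE A (\<lambda>_. I). \<Sum>j\<in>PiE B (\<lambda>_. I). norm (a (merge A i j)) powr (4 * p / (p + 2)))
      \<le> (sqrt 3 * C * L) powr (4 * p / (p + 2))"
    using A B I p C L0 rows cols by (intro Blei_two_block) (auto simp: finite_PiE)
  then show "(\<Sum>i\<in>PiE K (\<lambda>_. I). norm (a i) powr BH_exp (2 * n)) \<le> (sqrt 3 * C * L) powr BH_exp (2 * n)"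
    unfolding q AB(2)[symmetric] sum_PiE_union[OF AB(1)] .
qed

lemma array_BH_power_of_two:
  "array_BH TYPE('a::{real_normed_field, real_inner}) (2 ^ k) (sqrt 3 ^ k)"
proof (induction k)
  case 0
  then show ?case using array_BH_one by simp
next
  case (Suc k)
  then show ?case using array_BH_double[of "2 ^ k" "sqrt 3 ^ k"] by simp
qed

section \<open>From arrays to multilinear forms\<close>

lemma multilinear_expand_slot:
  fixes U :: "(nat \<Rightarrow> 'a::field vec) \<Rightarrow> 'a"
  assumes U: "multilinear_form n N U" and w: "w \<in> {..<n} \<rightarrow>\<^sub>E carrier_vec N" and k: "k < n"
    and v: "v \<in> carrier_vec N"
  shows "U (w(k := v)) = (\<Sum>j<N. v $ j * U (w(k := unit_vec N j)))"
proof -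
  define trunc where "trunc l = vec N (\<lambda>i. if i < l then v $ i else 0)" for l
  have add: "U (w(k := x + y)) = U (w(k := x)) + U (w(k := y))"
    and scale: "U (w(k := c \<cdot>\<^sub>v x)) = c * U (w(k := x))"
    if "x \<in> carrier_vec N" "y \<in> carrier_vec N" for c x y
    using U w k that unfolding multilinear_form_def by blast+
  have "U (w(k := trunc l)) = (\<Sum>j<l. v $ j * U (w(k := unit_vec N j)))" if "l \<le> N" for l
    using that
  proof (induction l)
    case 0
    have "trunc 0 = 0 \<cdot>\<^sub>v 0\<^sub>v N" by (auto simp: trunc_def)
    then show ?case using scale[of "0\<^sub>v N" "0\<^sub>v N" 0] by (simp del: fun_upd_apply)
  next
    case (Suc l)
    have "trunc (Suc l) = trunc l + v $ l \<cdot>\<^sub>v unit_vec N l"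
      using Suc.prems by (intro eq_vecI) (auto simp: trunc_def unit_vec_def less_Suc_eq)
    moreover have "trunc l \<in> carrier_vec N" by (simp add: trunc_def)
    ultimately show ?case using Suc by (simp add: add scale del: fun_upd_apply)
  qed
  moreover have "trunc N = v" using v by (intro eq_vecI) (auto simp: trunc_def)
  ultimately show ?thesis by force
qed

text \<open>
  The slots are expanded one after the other: \<open>h m i\<close> has basis vectors in its first \<open>m\<close> slots and the
  given vectors in the others.
\<close>

lemma multilinear_expand:
  fixes U :: "(nat \<Rightarrow> 'a::field vec) \<Rightarrow> 'a"
  assumes U: "multilinear_form n N U" and z: "z \<in> {..<n} \<rightarrow>\<^sub>E carrier_vec N"
  shows "U z = form {..<n} {..<N} (\<lambda>i. U (\<lambda>k\<in>{..<n}. unit_vec N (i k))) (\<lambda>k j. z k $ j)"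
proof -
  define h where "h m i = (\<lambda>k\<in>{..<n}. if k < m then unit_vec N (i k) else z k)" for m i
  have "U z = form {..<m} {..<N} (\<lambda>i. U (h m i)) (\<lambda>k j. z k $ j)" if "m \<le> n" for m
    using that
  proof (induction m)
    case 0
    have "h 0 i = z" for i using z by (auto simp: h_def fun_eq_iff PiE_def extensional_def)
    then show ?case by (simp add: form_def)
  next
    case (Suc m)
    have slot: "U (h m i) = (\<Sum>j<N. z m $ j * U (h (Suc m) (i(m := j))))" for i
    proof -
      have mem: "h m i \<in> {..<n} \<rightarrow>\<^sub>E carrier_vec N"
        using PiE_mem[OF z] by (auto simp: h_def restrict_PiE_iff)
      have "h m i = (h m i)(m := z m)" using Suc.prems by (auto simp: h_def fun_eq_iff)
      then have "U (h m i) = U ((h m i)(m := z m))" by simp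
      also have "\<dots> = (\<Sum>j<N. z m $ j * U ((h m i)(m := unit_vec N j)))"
        using Suc.prems PiE_mem[OF z] by (intro multilinear_expand_slot[OF U mem]) auto
      also have "\<dots> = (\<Sum>j<N. z m $ j * U (h (Suc m) (i(m := j))))"
      proof -
        have "(h m i)(m := unit_vec N j) = h (Suc m) (i(m := j))" for j
          using Suc.prems by (auto simp: h_def fun_eq_iff)
        then show ?thesis by (simp only:)
      qed
      finally show ?thesis .
    qed
    have prod: "(\<Prod>k<Suc m. z k $ (i(m := j)) k) = (\<Prod>k<m. z k $ i k) * z m $ j" for i j
      by (simp add: lessThan_Suc mult.commute)
    have split: "(\<Sum>i\<in>{..<Suc m} \<rightarrow>\<^sub>E {..<N}. F i)
        = (\<Sum>j<N. \<Sum>i\<in>{..<m} \<rightarrow>\<^sub>E {..<N}. F (i(m := j)))" for F :: "_ \<Rightarrow> 'a"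
      unfolding lessThan_Suc by (rule sum_PiE_insert) auto
    have "U z = (\<Sum>i\<in>{..<m} \<rightarrow>\<^sub>E {..<N}. \<Sum>j<N. (\<Prod>k<m. z k $ i k) * z m $ j * U (h (Suc m) (i(m := j))))"
      using Suc by (simp add: form_def slot sum_distrib_left mult.assoc)
    also have "\<dots> = form {..<Suc m} {..<N} (\<lambda>i. U (h (Suc m) i)) (\<lambda>k j. z k $ j)"
      unfolding form_def prod[symmetric] split by (rule sum.swap)
    finally show ?case .
  qed
  from this[of n] show ?thesis
    by (simp add: h_def cong: restrict_cong)
qed

text \<open>
  The supremum \<open>L\<close> over the open polydisc also bounds the form on the closed one: at a point \<open>w\<close> of
  the latter, homogeneity gives \<open>r\<^sup>n\<close> times the norm of the value \<open>\<le> L\<close> for \<open>0 < r < 1\<close>, and \<open>r\<close> tends to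
  \<open>1\<close>. That \<open>L\<close> is a true supremum follows from the bound by the sum of the norms of the
  coefficients.
\<close>

lemma BH_inequality_of_array_BH:
  fixes U :: "(nat \<Rightarrow> 'a::real_normed_field vec) \<Rightarrow> 'a"
  assumes BH: "array_BH TYPE('a) n C" and n: "n > 0" and C: "C \<ge> 0" and U: "multilinear_form n N U"
  shows "BH_inequality n N U C"
proof -
  define a where "a i = U (\<lambda>k\<in>{..<n}. unit_vec N (i k))" for i
  define D :: "(nat \<Rightarrow> 'a vec) set" where "D = {..<n} \<rightarrow>\<^sub>E polydisc N"
  define L where "L = (SUP z\<in>D. norm (U z))"
  let ?X = "{..<n} \<rightarrow>\<^sub>E {..<N}"
  have expand: "U z = form {..<n} {..<N} a (\<lambda>k j. z k $ j)" if "z \<in> D" for z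
    unfolding a_def using that
    by (intro multilinear_expand[OF U]) (auto simp: D_def polydisc_def PiE_iff)
  have bdd: "bdd_above ((\<lambda>z. norm (U z)) ` D)"
  proof (rule bdd_aboveI2)
    fix z assume z: "z \<in> D"
    have "norm (U z) \<le> (\<Sum>i\<in>?X. norm ((\<Prod>k<n. z k $ i k) * a i))"
      unfolding expand[OF z] form_def by (rule norm_sum)
    also have "\<dots> \<le> (\<Sum>i\<in>?X. norm (a i))"
    proof (rule sum_mono)
      fix i assume i: "i \<in> ?X"
      have "(\<Prod>k<n. norm (z k $ i k)) \<le> 1"
      proof (rule prod_le_1)
        fix k assume "k \<in> {..<n}"
        then have "z k \<in> polydisc N" "i k < N" using z i by (auto simp: D_def PiE_iff)
        then show "0 \<le> norm (z k $ i k) \<and> norm (z k $ i k) \<le> 1"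
          by (auto simp: polydisc_def less_imp_le)
      qed
      then show "norm ((\<Prod>k<n. z k $ i k) * a i) \<le> norm (a i)"
        by (simp add: norm_mult prod_norm[symmetric] mult_left_le_one_le prod_nonneg)
    qed
    finally show "norm (U z) \<le> (\<Sum>i\<in>?X. norm (a i))" .
  qed
  have L: "bounded_form {..<n} {..<N} a L"
    unfolding bounded_form_def
  proof (intro allI impI)
    fix w :: "nat \<Rightarrow> nat \<Rightarrow> 'a" assume w: "\<forall>k i. norm (w k i) \<le> 1"
    have small: "r ^ n * norm (form {..<n} {..<N} a w) \<le> L" if r: "0 < r" "r < 1" for r :: real
    proof -
      define z where "z = (\<lambda>k\<in>{..<n}. vec N (\<lambda>j. of_real r * w k j))"
      have "norm (of_real r * w k j) < 1" for k j
      proof -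
        have "r * norm (w k j) \<le> r * 1" using r w by (intro mult_left_mono) auto
        also have "\<dots> < 1" using r by simp
        finally show ?thesis using r by (simp add: norm_mult)
      qed
      then have z: "z \<in> D" by (auto simp: z_def D_def polydisc_def restrict_PiE_iff)
      have "U z = of_real (r ^ n) * form {..<n} {..<N} a w"
        unfolding expand[OF z] form_def sum_distrib_left
      proof (intro sum.cong refl)
        fix i assume i: "i \<in> ?X"
        have "(\<Prod>k<n. z k $ i k) = (\<Prod>k<n. of_real r * w k (i k))"
          using i by (intro prod.cong) (auto simp: z_def PiE_iff)
        then show "(\<Prod>k<n. z k $ i k) * a i = of_real (r ^ n) * ((\<Prod>k<n. w k (i k)) * a i)"
          by (simp add: prod.distrib)
      qed
      moreover have "norm (U z) \<le> L"
        unfolding L_def by (rule cSUP_upper[OF z bdd])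
      ultimately show ?thesis using r by (simp add: norm_mult norm_power)
    qed
    have "((\<lambda>r. r ^ n * norm (form {..<n} {..<N} a w)) \<longlongrightarrow> 1 ^ n * norm (form {..<n} {..<N} a w)) (at_left (1::real))"
      by (intro tendsto_intros)
    moreover have "\<forall>\<^sub>F r in at_left (1::real). r ^ n * norm (form {..<n} {..<N} a w) \<le> L"
      by (rule eventually_mono[OF eventually_at_left_real[of 0 1]]) (use small in auto)
    ultimately show "norm (form {..<n} {..<N} a w) \<le> L"
      by (auto dest: tendsto_upperbound)
  qed
  define p where "p = BH_exp n"
  have p: "p > 0" using n by (simp add: p_def BH_exp_def)
  have "(\<Sum>i\<in>?X. norm (a i) powr p) \<le> (C * L) powr p"
    using BH L unfolding array_BH_def p_def by (metis card_lessThan finite_lessThan)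
  then have "(\<Sum>i\<in>?X. norm (a i) powr p) powr (1 / p) \<le> ((C * L) powr p) powr (1 / p)"
    using p by (intro powr_mono2) (auto intro: sum_nonneg)
  also have "\<dots> = C * L"
    using C p bounded_form_nonneg[OF L] by (simp add: powr_powr)
  finally show ?thesis
    unfolding BH_inequality_def by (simp add: p_def BH_exp_def a_def L_def D_def)
qed

text \<open>
  The admissible constants form a closed set that is bounded below, so once it is nonempty
  its infimum belongs to it and is its least element.
\<close>

lemma BH_const_bounds:
  assumes BH: "array_BH TYPE('a::real_normed_field) n C" and n: "n > 0" and C: "C \<ge> 1"
  shows "1 \<le> BH_const TYPE('a) n" and "BH_const TYPE('a) n \<le> C"
proof -
  define P where "P c \<longleftrightarrow> 1 \<le> c \<and> (\<forall>N\<ge>1. \<forall>U :: (nat \<Rightarrow> 'a vec) \<Rightarrow> 'a.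
            multilinear_form n N U \<longrightarrow> BH_inequality n N U c)" for c
  have PC: "P C"
    unfolding P_def using BH_inequality_of_array_BH[OF BH n] C by auto
  have "closed (Collect P)"
    unfolding P_def BH_inequality_def
    by (intro closed_Collect_conj closed_Collect_all closed_Collect_imp closed_Collect_le
        continuous_intros) auto
  moreover have bdd: "bdd_below (Collect P)"
    by (rule bdd_belowI[of _ 1]) (simp add: P_def)
  ultimately have PI: "P (Inf (Collect P))"
    using closed_contains_Inf[of "Collect P"] PC by auto
  have "BH_const TYPE('a) n = Inf (Collect P)"
    unfolding BH_const_def P_def[symmetric]
    by (rule Least_equality[where P = P, OF PI]) (simp add: cInf_lower bdd)
  moreover have "Inf (Collect P) \<le> C" using PC bdd by (simp add: cInf_lower)
  ultimately show "1 \<le> BH_const TYPE('a) n" "BH_const TYPE('a) n \<le> C"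
    using PI by (auto simp: P_def)
qed

section \<open>The limit of the increments\<close>

lemma increment_limit_zero:
  fixes K :: "nat \<Rightarrow> real"
  assumes lim: "(\<lambda>n. ereal (K (n + 1) - K n)) \<longlonglongrightarrow> M"
    and lower: "\<And>k. A \<le> K (2 ^ k)" and upper: "\<And>k. K (2 ^ k) \<le> b ^ k" and b: "0 \<le> b" "b < 2"
  shows "M = 0"
proof (rule ccontr)
  assume "M \<noteq> 0"
  then consider "0 < M" | "M < 0" by (meson less_linear)
  then show False
  proof cases
    case 1
    then obtain c where c: "0 < ereal c" "ereal c < M" using ereal_dense2 by blast
    from order_tendstoD(1)[OF lim c(2)] obtain m where m: "\<And>n. n \<ge> m \<Longrightarrow> c < K (n + 1) - K n"
      by (auto simp: eventually_sequentially)
    have grow: "K m + c * (real n - real m) \<le> K n" if "n \<ge> m" for n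
      using that
    proof (induction n rule: dec_induct)
      case (step n)
      then show ?case using m[of n] by (simp add: algebra_simps)
    qed simp
    \<comment> \<open>The two estimates give \<open>K m + c * (2 ^ k - m) \<le> b ^ k\<close>; divided by \<open>2 ^ k\<close>, this fails for large \<open>k\<close>.\<close>
    have "(\<lambda>k. (b / 2) ^ k + (c * real m - K m) * (1 / 2) ^ k) \<longlonglongrightarrow> 0 + (c * real m - K m) * 0"
      using b by (intro tendsto_intros LIMSEQ_power_zero) auto
    moreover have "0 + (c * real m - K m) * 0 < c" using c by simp
    ultimately have "\<forall>\<^sub>F k in sequentially. (b / 2) ^ k + (c * real m - K m) * (1 / 2) ^ k < c"
      by (rule order_tendstoD)
    then have "\<forall>\<^sub>F k in sequentially. m \<le> k \<and> (b / 2) ^ k + (c * real m - K m) * (1 / 2) ^ k < c"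
      by (rule eventually_conj[OF eventually_ge_at_top])
    then obtain k where k: "k \<ge> m" "(b / 2) ^ k + (c * real m - K m) * (1 / 2) ^ k < c"
      using eventually_happens'[OF sequentially_bot] by blast
    then have "b ^ k + (c * real m - K m) < c * 2 ^ k"
      by (simp add: power_divide field_simps)
    moreover have "m \<le> 2 ^ k" using k(1) less_exp[of k] by linarith
    then have "K m + c * (2 ^ k - real m) \<le> b ^ k"
      using grow[of "2 ^ k"] upper[of k] by simp
    ultimately show False by (simp add: algebra_simps)
  next
    case 2
    then obtain c where c: "M < ereal c" "ereal c < 0" using ereal_dense2 by blast
    from order_tendstoD(2)[OF lim c(1)] obtain m where m: "\<And>n. n \<ge> m \<Longrightarrow> K (n + 1) - K n < c"
      by (auto simp: eventually_sequentially)
    have decay: "K n \<le> K m + c * (real n - real m)" if "n \<ge> m" for n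
      using that
    proof (induction n rule: dec_induct)
      case (step n)
      then show ?case using m[of n] by (simp add: algebra_simps)
    qed simp
    obtain j where j: "(K m - c * real m - A) / (- c) < real j" using reals_Archimedean2 by blast
    define k where "k = max j m"
    have "j \<le> k" "m \<le> k" by (auto simp: k_def)
    then have "j < 2 ^ k" and mk: "m \<le> 2 ^ k" using less_exp[of k] by linarith+
    then have "(K m - c * real m - A) / (- c) < 2 ^ k"
      using j by (metis less_trans of_nat_less_iff of_nat_numeral of_nat_power)
    then have "K m - c * real m - A < - c * 2 ^ k"
      using c by (subst (asm) pos_divide_less_eq) (auto simp: mult.commute)
    moreover have "A \<le> K m + c * (2 ^ k - real m)"
      using decay[OF mk] lower[of k] by simp
    ultimately show False by (simp add: algebra_simps)
  qed
qed

lemma BH_const_increment_limit: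
  assumes "(\<lambda>n. ereal (BH_const TYPE('a::{real_normed_field, real_inner}) (n + 1)
      - BH_const TYPE('a) n)) \<longlonglongrightarrow> M"
  shows "M = 0"
proof (rule increment_limit_zero[OF assms])
  fix k :: nat
  have "1 \<le> sqrt 3 ^ k" by (rule one_le_power) simp
  then show "1 \<le> BH_const TYPE('a) (2 ^ k)" "BH_const TYPE('a) (2 ^ k) \<le> sqrt 3 ^ k"
    using BH_const_bounds[OF array_BH_power_of_two[where 'a = 'a and k = k]] by auto
  show "sqrt 3 < 2" by (rule real_less_lsqrt) auto
qed simp

theorem theorem8p1:
  shows "(\<forall>M::ereal.
            (\<lambda>n. ereal (BH_const TYPE(real) (n + 1) - BH_const TYPE(real) n))
              \<longlonglongrightarrow> M \<longrightarrow> M = 0) \<and>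
         (\<forall>M::ereal.
            (\<lambda>n. ereal (BH_const TYPE(complex) (n + 1) - BH_const TYPE(complex) n))
              \<longlonglongrightarrow> M \<longrightarrow> M = 0)"
  by (intro conjI allI impI; erule BH_const_increment_limit)

end
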